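(* (Upstream Variables Theorem) Let $G$ be a DAG and let $H\cup O$ be an upstream partition of the vertices of $G$. Then every minimal generating set of $I_G$ that is homogeneous with respect to the upstream grading contains a minimal generating set of $I_{G,O}$.
   Context: Let $G$ be a directed acyclic graph (DAG) with vertex set $[n]=\{1,\dots,n\}$, numerically ordered: $i\to j\in E(G)$ only if $i<j$. A collider is a pair of edges $i\to k$, $j\to k$ with the same head. For vertices $i,j$, let $T(i,j)$ be the set of treks from $i$ to $j$: simple paths $P$ in (the underlying undirected graph of) $G$ from $i$ to $j$ containing no collider. Each trek goes from $i$ up to a topmost vertex $\mathrm{top}(P)$ and then down to $j$; $T(i,i)$ consists of the single empty trek, with top $i$. Let $\mathbb{C}[\Sigma]=\mathbb{C}[\sigma_{ij}\mid 1\le i\le j\le n]$, $\sigma_{ij}=\sigma_{ji}$, and let $\phi_G:\mathbb{C}[\Sigma]\to\mathbb{C}[a_i,\lambda_{ij}\mid i\in[n],\ i\to j\in E(G)]$ be the ring homomorphism $\sigma_{ij}\mapsto\sum_{P\in T(i,j)}a_{\mathrm{top}(P)}\prod_{k\to l\in P}\lambda_{kl}$ (so $\sigma_{ii}\mapsto a_i$, and $\sigma_{ij}\mapsto 0$ if $T(i,j)=\emptyset$). Set $I_G=\ker\phi_G$, and for $O\subseteq[n]$ set $I_{G,O}=I_G\cap\mathbb{C}[\sigma_{ij}\mid i,j\in O]$, an ideal of $\mathbb{C}[\sigma_{ij}\mid i,j\in O]$. A partition $H\cup O=[n]$ (hidden and observed nodes) is upstream if there is no edge $o\to h$ in $G$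 with $o\in O$ and $h\in H$. The upstream grading on $\mathbb{C}[\Sigma]$ is the $\mathbb{Z}^2$-grading with $\deg\sigma_{ij}=(1,0)$ if $i,j\in H$; $(1,1)$ if one of $i,j$ is in $H$ and the other in $O$; and $(1,2)$ if $i,j\in O$. The ideal $I_G$ is homogeneous with respect to it. *)

theory Defs
  imports Complex_Main "HOL-Library.Poly_Mapping" "HOL-Algebra.RingHom"
begin

section \<open>Polynomial rings over the complex numbers\<close>

text \<open>
  Polynomials in variables of type \<open>'v\<close>: finitely supported maps from monomials (themselves
  finitely supported exponent maps) to coefficients. The ring structure on this type is the
  convolution structure of \<^theory>\<open>HOL-Library.Poly_Mapping\<close>.
\<close>

type_synonym 'v cpoly = "('v \<Rightarrow>\<^sub>0 nat) \<Rightarrow>\<^sub>0 complex"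

definition poly_const :: "complex \<Rightarrow> 'v cpoly"
  where "poly_const c = Poly_Mapping.single 0 c"

definition poly_var :: "'v \<Rightarrow> 'v cpoly"
  where "poly_var v = Poly_Mapping.single (Poly_Mapping.single v 1) 1"

definition poly_vars :: "'v cpoly \<Rightarrow> 'v set"
  where "poly_vars p = (\<Union>m\<in>Poly_Mapping.keys p. Poly_Mapping.keys m)"

definition poly_ring :: "'v set \<Rightarrow> 'v cpoly ring"
  where "poly_ring V =
    \<lparr>carrier = {p. poly_vars p \<subseteq> V}, mult = (*), one = 1, zero = 0, add = (+)\<rparr>"

definition eval_monom :: "('v \<Rightarrow> 'w cpoly) \<Rightarrow> ('v \<Rightarrow>\<^sub>0 nat) \<Rightarrow> 'w cpoly"
  where "eval_monom f m = (\<Prod>v\<in>Poly_Mapping.keys m. f v ^ Poly_Mapping.lookup m v)"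

text \<open>The \<open>\<complex>\<close>-algebra homomorphism sending each variable \<open>v\<close> to \<open>f v\<close>.\<close>

definition poly_subst :: "('v \<Rightarrow> 'w cpoly) \<Rightarrow> 'v cpoly \<Rightarrow> 'w cpoly"
  where "poly_subst f p =
    (\<Sum>m\<in>Poly_Mapping.keys p. poly_const (Poly_Mapping.lookup p m) * eval_monom f m)"

lemma carrier_poly_ring [simp]: "carrier (poly_ring V) = {p. poly_vars p \<subseteq> V}"
  and mult_poly_ring [simp]: "mult (poly_ring V) = (*)"
  and one_poly_ring [simp]: "one (poly_ring V) = 1"
  and zero_poly_ring [simp]: "zero (poly_ring V) = 0"
  and add_poly_ring [simp]: "add (poly_ring V) = (+)"
  by (simp_all add: poly_ring_def)

lemma poly_vars_zero [simp]: "poly_vars 0 = {}"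
  and poly_vars_one [simp]: "poly_vars 1 = {}"
  and poly_vars_uminus [simp]: "poly_vars (- p) = poly_vars p"
  by (auto simp: poly_vars_def in_keys_iff)

lemma poly_vars_const [simp]: "poly_vars (poly_const c) = {}"
  by (auto simp: poly_vars_def poly_const_def)

lemma poly_vars_var [simp]: "poly_vars (poly_var v) = {v}"
  by (auto simp: poly_vars_def poly_var_def)

lemma poly_vars_add: "poly_vars (p + q) \<subseteq> poly_vars p \<union> poly_vars q"
  using Poly_Mapping.keys_add[of p q] by (auto simp: poly_vars_def)

lemma poly_vars_mult: "poly_vars (p * q) \<subseteq> poly_vars p \<union> poly_vars q"
proof
  fix v assume "v \<in> poly_vars (p * q)"
  then obtain m where m: "m \<in> Poly_Mapping.keys (p * q)" "v \<in> Poly_Mapping.keys m"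
    by (auto simp: poly_vars_def)
  then obtain a b where "m = a + b" "a \<in> Poly_Mapping.keys p" "b \<in> Poly_Mapping.keys q"
    using keys_mult[of p q] by auto
  with m(2) show "v \<in> poly_vars p \<union> poly_vars q"
    using Poly_Mapping.keys_add[of a b] by (auto simp: poly_vars_def)
qed

lemma cring_poly_ring: "cring (poly_ring V)"
proof (rule cringI)
  show "abelian_group (poly_ring V)"
  proof (rule abelian_groupI)
    fix p assume "p \<in> carrier (poly_ring V)"
    then show "\<exists>q\<in>carrier (poly_ring V). q \<oplus>\<^bsub>poly_ring V\<^esub> p = \<zero>\<^bsub>poly_ring V\<^esub>"
      by (intro bexI[of _ "- p"]) auto
  next
    fix p q assume "p \<in> carrier (poly_ring V)" "q \<in> carrier (poly_ring V)"
    then show "p \<oplus>\<^bsub>poly_ring V\<^esub> q \<in> carrier (poly_ring V)"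
      using poly_vars_add[of p q] by auto
  qed (auto simp: add_ac)
  show "comm_monoid (poly_ring V)"
  proof (rule comm_monoidI)
    fix p q assume "p \<in> carrier (poly_ring V)" "q \<in> carrier (poly_ring V)"
    then show "p \<otimes>\<^bsub>poly_ring V\<^esub> q \<in> carrier (poly_ring V)"
      using poly_vars_mult[of p q] by auto
  qed (auto simp: mult_ac)
qed (auto simp: algebra_simps)

lemma poly_const_add: "poly_const (c + d) = poly_const c + poly_const d"
  by (simp add: poly_const_def single_add)

lemma poly_const_mult: "poly_const (c * d) = poly_const c * poly_const d"
  by (simp add: poly_const_def mult_single)

lemma poly_const_zero [simp]: "poly_const 0 = 0"
  and poly_const_one [simp]: "poly_const 1 = 1"
  by (simp_all add: poly_const_def)

lemma eval_monom_superset: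
  assumes "finite A" "Poly_Mapping.keys m \<subseteq> A"
  shows "eval_monom f m = (\<Prod>v\<in>A. f v ^ Poly_Mapping.lookup m v)"
  unfolding eval_monom_def using assms
  by (intro prod.mono_neutral_left) (auto simp: in_keys_iff)

lemma eval_monom_zero [simp]: "eval_monom f 0 = 1"
  by (simp add: eval_monom_def)

lemma eval_monom_add: "eval_monom f (a + b) = eval_monom f a * eval_monom f b"
proof -
  let ?A = "Poly_Mapping.keys a \<union> Poly_Mapping.keys b"
  have "eval_monom f (a + b) = (\<Prod>v\<in>?A. f v ^ Poly_Mapping.lookup (a + b) v)"
    using Poly_Mapping.keys_add[of a b] by (intro eval_monom_superset) auto
  also have "\<dots> = (\<Prod>v\<in>?A. f v ^ Poly_Mapping.lookup a v) * (\<Prod>v\<in>?A. f v ^ Poly_Mapping.lookup b v)"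
    by (simp add: lookup_add power_add prod.distrib)
  also have "\<dots> = eval_monom f a * eval_monom f b"
    by (subst (1 2) eval_monom_superset[of ?A]) auto
  finally show ?thesis .
qed

lemma poly_subst_superset:
  assumes "finite A" "Poly_Mapping.keys p \<subseteq> A"
  shows "poly_subst f p = (\<Sum>m\<in>A. poly_const (Poly_Mapping.lookup p m) * eval_monom f m)"
  unfolding poly_subst_def using assms
  by (intro sum.mono_neutral_left) (auto simp: in_keys_iff)

lemma poly_subst_add: "poly_subst f (p + q) = poly_subst f p + poly_subst f q"
proof -
  let ?A = "Poly_Mapping.keys p \<union> Poly_Mapping.keys q"
  have "poly_subst f (p + q) =
      (\<Sum>m\<in>?A. poly_const (Poly_Mapping.lookup (p + q) m) * eval_monom f m)"
    using Poly_Mapping.keys_add[of p q] by (intro poly_subst_superset) auto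
  also have "\<dots> = (\<Sum>m\<in>?A. poly_const (Poly_Mapping.lookup p m) * eval_monom f m) +
      (\<Sum>m\<in>?A. poly_const (Poly_Mapping.lookup q m) * eval_monom f m)"
    by (simp add: lookup_add poly_const_add ring_distribs sum.distrib)
  also have "\<dots> = poly_subst f p + poly_subst f q"
    by (subst (1 2) poly_subst_superset[of ?A]) auto
  finally show ?thesis .
qed

lemma poly_subst_zero [simp]: "poly_subst f 0 = 0"
  by (simp add: poly_subst_def)

lemma poly_subst_sum: "poly_subst f (\<Sum>i\<in>I. g i) = (\<Sum>i\<in>I. poly_subst f (g i))"
  by (induction I rule: infinite_finite_induct) (auto simp: poly_subst_add)

lemma poly_subst_single:
  "poly_subst f (Poly_Mapping.single m c) = poly_const c * eval_monom f m"
  by (subst poly_subst_superset[of "{m}"]) auto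

lemma cpoly_sum_single:
  fixes p :: "'v cpoly"
  shows "p = (\<Sum>m\<in>Poly_Mapping.keys p. Poly_Mapping.single m (Poly_Mapping.lookup p m))"
proof (rule poly_mapping_eqI)
  fix k
  show "Poly_Mapping.lookup p k = Poly_Mapping.lookup
      (\<Sum>m\<in>Poly_Mapping.keys p. Poly_Mapping.single m (Poly_Mapping.lookup p m)) k"
    by (auto simp: lookup_sum lookup_single when_def in_keys_iff)
qed

lemma poly_subst_mult: "poly_subst f (p * q) = poly_subst f p * poly_subst f q"
proof -
  let ?s = "\<lambda>p m. Poly_Mapping.single m (Poly_Mapping.lookup p m)"
  have "p * q = (\<Sum>a\<in>Poly_Mapping.keys p. ?s p a) * (\<Sum>b\<in>Poly_Mapping.keys q. ?s q b)"
    by (rule arg_cong2[of _ _ _ _ "(*)", OF cpoly_sum_single cpoly_sum_single])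
  also have "\<dots> = (\<Sum>a\<in>Poly_Mapping.keys p. \<Sum>b\<in>Poly_Mapping.keys q. ?s p a * ?s q b)"
    by (rule sum_product)
  finally have "poly_subst f (p * q) =
      poly_subst f (\<Sum>a\<in>Poly_Mapping.keys p. \<Sum>b\<in>Poly_Mapping.keys q. ?s p a * ?s q b)"
    by (rule arg_cong)
  also have "\<dots> =
      (\<Sum>a\<in>Poly_Mapping.keys p. \<Sum>b\<in>Poly_Mapping.keys q. poly_subst f (?s p a * ?s q b))"
    by (simp only: poly_subst_sum)
  also have "\<dots> = (\<Sum>a\<in>Poly_Mapping.keys p. \<Sum>b\<in>Poly_Mapping.keys q.
      poly_subst f (?s p a) * poly_subst f (?s q b))"
    by (simp add: mult_single poly_subst_single eval_monom_add poly_const_mult mult_ac)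
  also have "\<dots> = poly_subst f p * poly_subst f q"
    by (simp add: poly_subst_single poly_subst_def[of f p] poly_subst_def[of f q] sum_product)
  finally show ?thesis .
qed

lemma poly_subst_one [simp]: "poly_subst f 1 = 1"
  by (simp add: poly_subst_def)

lemma poly_subst_const [simp]: "poly_subst f (poly_const c) = poly_const c"
  unfolding poly_const_def[of c] by (simp add: poly_subst_single poly_const_def)

lemma poly_subst_var [simp]: "poly_subst f (poly_var v) = f v"
  unfolding poly_var_def by (simp add: poly_subst_single eval_monom_def)

lemma poly_vars_sum: "poly_vars (\<Sum>i\<in>I. g i) \<subseteq> (\<Union>i\<in>I. poly_vars (g i))"
proof (induction I rule: infinite_finite_induct)
  case (insert i I)
  then show ?case using poly_vars_add[of "g i" "sum g I"] by auto
qed auto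

lemma poly_vars_prod: "poly_vars (\<Prod>i\<in>I. g i) \<subseteq> (\<Union>i\<in>I. poly_vars (g i))"
proof (induction I rule: infinite_finite_induct)
  case (insert i I)
  then show ?case using poly_vars_mult[of "g i" "prod g I"] by auto
qed auto

lemma poly_vars_power: "poly_vars (p ^ k) \<subseteq> poly_vars p"
proof (induction k)
  case (Suc k)
  then show ?case using poly_vars_mult[of p "p ^ k"] by auto
qed auto

lemma poly_vars_subst: "poly_vars (poly_subst f p) \<subseteq> (\<Union>v\<in>poly_vars p. poly_vars (f v))"
proof -
  have "poly_vars (poly_const c * eval_monom f m) \<subseteq> (\<Union>v\<in>Poly_Mapping.keys m. poly_vars (f v))"
    for c m
  proof -
    have "poly_vars (eval_monom f m) \<subseteq>
        (\<Union>v\<in>Poly_Mapping.keys m. poly_vars (f v ^ Poly_Mapping.lookup m v))"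
      unfolding eval_monom_def by (rule poly_vars_prod)
    also have "\<dots> \<subseteq> (\<Union>v\<in>Poly_Mapping.keys m. poly_vars (f v))"
      by (intro UN_mono order.refl poly_vars_power)
    finally show ?thesis
      using poly_vars_mult[of "poly_const c" "eval_monom f m"] by auto
  qed
  then have "(\<Union>m\<in>Poly_Mapping.keys p.
        poly_vars (poly_const (Poly_Mapping.lookup p m) * eval_monom f m))
      \<subseteq> (\<Union>m\<in>Poly_Mapping.keys p. \<Union>v\<in>Poly_Mapping.keys m. poly_vars (f v))"
    by (rule UN_mono[OF order.refl])
  then show ?thesis
    unfolding poly_subst_def
    by (intro order.trans[OF poly_vars_sum]) (auto simp: poly_vars_def)
qed

lemma poly_subst_ring_hom:
  assumes "\<And>v. v \<in> V \<Longrightarrow> f v \<in> carrier (poly_ring W)"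
  shows "poly_subst f \<in> ring_hom (poly_ring V) (poly_ring W)"
proof (rule ring_hom_memI)
  fix p assume "p \<in> carrier (poly_ring V)"
  then show "poly_subst f p \<in> carrier (poly_ring W)"
    using poly_vars_subst[of f p] assms by fastforce
qed (simp_all add: poly_subst_add poly_subst_mult)


section \<open>Ordered directed acyclic graphs and treks\<close>

text \<open>A pair \<open>(i, j)\<close> in the edge set is the edge \<open>i \<rightarrow> j\<close>; the vertex set is \<open>{1..n}\<close>.\<close>

definition ordered_dag :: "nat \<Rightarrow> (nat \<times> nat) set \<Rightarrow> bool"
  where "ordered_dag n E \<longleftrightarrow> E \<subseteq> {(i, j). 1 \<le> i \<and> i < j \<and> j \<le> n}"

text \<open>
  A path is given by the list of its vertices. Since at most one edge joins two
  vertices of an ordered DAG, the list determines which edges are traversed.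
\<close>

definition path_edges :: "(nat \<times> nat) set \<Rightarrow> nat list \<Rightarrow> (nat \<times> nat) set"
  where "path_edges E P =
    {(k, l) \<in> E. (k, l) \<in> set (zip P (tl P)) \<or> (l, k) \<in> set (zip P (tl P))}"

definition simple_path :: "nat \<Rightarrow> (nat \<times> nat) set \<Rightarrow> nat \<Rightarrow> nat \<Rightarrow> nat list \<Rightarrow> bool"
  where "simple_path n E i j P \<longleftrightarrow>
    P \<noteq> [] \<and> hd P = i \<and> last P = j \<and> distinct P \<and> set P \<subseteq> {1..n} \<and>
    successively (\<lambda>k l. (k, l) \<in> E \<or> (l, k) \<in> E) P"

definition has_collider :: "(nat \<times> nat) set \<Rightarrow> bool"
  where "has_collider F \<longleftrightarrow> (\<exists>i j k. i \<noteq> j \<and> (i, k) \<in> F \<and> (j, k) \<in> F)"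

definition treks :: "nat \<Rightarrow> (nat \<times> nat) set \<Rightarrow> nat \<Rightarrow> nat \<Rightarrow> nat list set"
  where "treks n E i j = {P. simple_path n E i j P \<and> \<not> has_collider (path_edges E P)}"

text \<open>The topmost vertex of a trek is its unique vertex that is not the head of one of its edges
  (see \<open>ex1_trek_top\<close> below).\<close>

definition trek_top :: "(nat \<times> nat) set \<Rightarrow> nat list \<Rightarrow> nat"
  where "trek_top E P = (THE v. v \<in> set P \<and> (\<forall>u. (u, v) \<notin> path_edges E P))"


section \<open>The trek parametrization and its vanishing ideal\<close>

text \<open>
  The variable \<open>\<sigma>\<^sub>i\<^sub>j = \<sigma>\<^sub>j\<^sub>i\<close> is represented by the pair \<open>(i, j)\<close> with \<open>i \<le> j\<close>.
\<close>

definition sigma_vars :: "nat set \<Rightarrow> (nat \<times> nat) set"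
  where "sigma_vars A = {(i, j). i \<in> A \<and> j \<in> A \<and> i \<le> j}"

abbreviation sigma_ring :: "nat set \<Rightarrow> (nat \<times> nat) cpoly ring"
  where "sigma_ring A \<equiv> poly_ring (sigma_vars A)"

datatype param = Avar nat | Lvar nat nat

definition param_vars :: "nat \<Rightarrow> (nat \<times> nat) set \<Rightarrow> param set"
  where "param_vars n E = Avar ` {1..n} \<union> (\<lambda>(k, l). Lvar k l) ` E"

definition trek_monomial :: "(nat \<times> nat) set \<Rightarrow> nat list \<Rightarrow> param cpoly"
  where "trek_monomial E P =
    poly_var (Avar (trek_top E P)) * (\<Prod>(k, l)\<in>path_edges E P. poly_var (Lvar k l))"

definition phi :: "nat \<Rightarrow> (nat \<times> nat) set \<Rightarrow> (nat \<times> nat) cpoly \<Rightarrow> param cpoly"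
  where "phi n E = poly_subst (\<lambda>(i, j). \<Sum>P\<in>treks n E i j. trek_monomial E P)"

definition I_graph :: "nat \<Rightarrow> (nat \<times> nat) set \<Rightarrow> (nat \<times> nat) cpoly set"
  where "I_graph n E = a_kernel (sigma_ring {1..n}) (poly_ring (param_vars n E)) (phi n E)"

definition I_graph_obs :: "nat \<Rightarrow> (nat \<times> nat) set \<Rightarrow> nat set \<Rightarrow> (nat \<times> nat) cpoly set"
  where "I_graph_obs n E Obs = I_graph n E \<inter> carrier (sigma_ring Obs)"

lemma finite_treks: "finite (treks n E i j)"
proof (rule finite_subset)
  show "treks n E i j \<subseteq> {P. set P \<subseteq> {1..n} \<and> distinct P}"
    by (auto simp: treks_def simple_path_def)
qed (rule finite_subset_distinct, simp)

lemma treks_refl: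
  assumes "i \<in> {1..n}"
  shows "treks n E i i = {[i]}"
proof -
  have "P = [i]" if "simple_path n E i i P" for P
  proof -
    have "P \<noteq> []" "hd P = i" "last P = i" "distinct P"
      using that by (simp_all add: simple_path_def)
    then show ?thesis
      by (metis distinct.simps(2) last.simps last_in_set list.collapse)
  qed
  moreover have "simple_path n E i i [i]" "\<not> has_collider (path_edges E [i])"
    using assms by (auto simp: simple_path_def has_collider_def path_edges_def)
  ultimately show ?thesis
    unfolding treks_def by blast
qed

lemma path_edges_Cons_Cons:
  "path_edges E (x # y # Q) = path_edges E (y # Q) \<union> ({(x, y), (y, x)} \<inter> E)"
  by (auto simp: path_edges_def)

lemma path_edges_subset: "path_edges E P \<subseteq> E \<inter> (set P \<times> set P)"
  by (cases P) (auto simp: path_edges_def dest: set_zip_leftD set_zip_rightD)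

lemma ex1_trek_top:
  assumes dag: "ordered_dag n E" and P: "P \<in> treks n E i j"
  shows "\<exists>!v. v \<in> set P \<and> (\<forall>u. (u, v) \<notin> path_edges E P)"
proof -
  have asym: "(l, k) \<notin> E" if "(k, l) \<in> E" for k l
    using subsetD[OF dag[unfolded ordered_dag_def], of "(k, l)"]
      subsetD[OF dag[unfolded ordered_dag_def], of "(l, k)"] that by auto
  have "P \<noteq> [] \<Longrightarrow> distinct P \<Longrightarrow> \<not> has_collider (path_edges E P) \<Longrightarrow>
      successively (\<lambda>k l. (k, l) \<in> E \<or> (l, k) \<in> E) P \<Longrightarrow>
      \<exists>!v. v \<in> set P \<and> (\<forall>u. (u, v) \<notin> path_edges E P)"
  proof (induction P rule: induct_list012)
    case (2 x)
    show ?case by (simp add: path_edges_def)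
  next
    case (3 x y Q)
    let ?F = "path_edges E (y # Q)" and ?F' = "path_edges E (x # y # Q)"
    have F': "?F' = ?F \<union> ({(x, y), (y, x)} \<inter> E)"
      by (rule path_edges_Cons_Cons)
    have sub: "?F \<subseteq> set (y # Q) \<times> set (y # Q)"
      using path_edges_subset[of E "y # Q"] by blast
    have x: "x \<notin> set (y # Q)" using 3 by simp
    have "\<not> has_collider ?F"
      using 3(5) unfolding F' has_collider_def by blast
    moreover have "distinct (y # Q)" "successively (\<lambda>k l. (k, l) \<in> E \<or> (l, k) \<in> E) (y # Q)"
      using 3(4,6) by simp_all
    ultimately have "\<exists>!v. v \<in> set (y # Q) \<and> (\<forall>u. (u, v) \<notin> ?F)"
      by (intro 3(2)) (rule list.distinct(2))
    then obtain v where v: "v \<in> set (y # Q)" "\<And>u. (u, v) \<notin> ?F"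
      and uniq: "\<And>w. w \<in> set (y # Q) \<Longrightarrow> (\<And>u. (u, w) \<notin> ?F) \<Longrightarrow> w = v"
      by (elim ex1E) blast
    have set: "set (x # y # Q) = insert x (set (y # Q))" by (rule list.set(2))
    show ?case
    proof (cases "(x, y) \<in> E")
      case True
      have y: "(u, y) \<notin> ?F" for u
      proof
        assume u: "(u, y) \<in> ?F"
        then have "u \<noteq> x" using sub x by blast
        with u True 3(5) show False
          unfolding F' has_collider_def by blast
      qed
      then have "y = v" by (intro uniq) simp_all
      have eq: "?F' = insert (x, y) ?F" using F' True asym by blast
      show ?thesis
      proof (rule ex1I[of _ x])
        have "x \<noteq> y" using x by simp
        then show "x \<in> set (x # y # Q) \<and> (\<forall>u. (u, x) \<notin> ?F')"
          unfolding eq set using sub x by blast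
      next
        fix w assume w: "w \<in> set (x # y # Q) \<and> (\<forall>u. (u, w) \<notin> ?F')"
        show "w = x"
        proof (rule ccontr)
          assume "w \<noteq> x"
          with w have "w = v" unfolding eq set by (intro uniq) blast+
          with w \<open>y = v\<close> show False unfolding eq by blast
        qed
      qed
    next
      case False
      then have yx: "(y, x) \<in> E" using 3(6) by simp
      have eq: "?F' = insert (y, x) ?F" using F' False yx by blast
      show ?thesis
      proof (rule ex1I[of _ v])
        have "v \<noteq> x" using v x by blast
        then show "v \<in> set (x # y # Q) \<and> (\<forall>u. (u, v) \<notin> ?F')"
          unfolding eq set using v by blast
      next
        fix w assume w: "w \<in> set (x # y # Q) \<and> (\<forall>u. (u, w) \<notin> ?F')"
        then have "w \<noteq> x" unfolding eq by blast
        with w show "w = v" unfolding eq set by (intro uniq) blast+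
      qed
    qed
  qed simp
  moreover have "P \<noteq> []" "distinct P" "\<not> has_collider (path_edges E P)"
      "successively (\<lambda>k l. (k, l) \<in> E \<or> (l, k) \<in> E) P"
    using P by (simp_all add: treks_def simple_path_def)
  ultimately show ?thesis by blast
qed

lemma phi_ring_hom:
  assumes dag: "ordered_dag n E"
  shows "phi n E \<in> ring_hom (sigma_ring {1..n}) (poly_ring (param_vars n E))"
  unfolding phi_def
proof (rule poly_subst_ring_hom)
  fix v :: "nat \<times> nat"
  obtain i j where v: "v = (i, j)" by (cases v)
  have "poly_vars (trek_monomial E P) \<subseteq> param_vars n E" if P: "P \<in> treks n E i j" for P
  proof -
    have "trek_top E P \<in> set P"
      using theI'[OF ex1_trek_top[OF dag P]] by (simp add: trek_top_def)
    then have "trek_top E P \<in> {1..n}"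
      using P by (auto simp: treks_def simple_path_def)
    moreover have "poly_vars (\<Prod>(k, l)\<in>path_edges E P. poly_var (Lvar k l)) \<subseteq>
        (\<Union>(k, l)\<in>path_edges E P. {Lvar k l})"
      by (rule order.trans[OF poly_vars_prod]) auto
    moreover have "path_edges E P \<subseteq> E"
      using path_edges_subset by blast
    ultimately show ?thesis
      unfolding trek_monomial_def
      by (intro order.trans[OF poly_vars_mult]) (fastforce simp: param_vars_def)
  qed
  then show "(case v of (i, j) \<Rightarrow> \<Sum>P\<in>treks n E i j. trek_monomial E P)
      \<in> carrier (poly_ring (param_vars n E))"
    using poly_vars_sum[of "trek_monomial E" "treks n E i j"] unfolding v
    by (simp add: subset_iff) (meson UN_iff)
qed

lemma phi_diag:
  assumes "i \<in> {1..n}"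
  shows "phi n E (poly_var (i, i)) = poly_var (Avar i)"
proof -
  have "trek_top E [i] = i"
    by (auto simp: trek_top_def path_edges_def)
  then show ?thesis
    using assms by (simp add: phi_def treks_refl trek_monomial_def path_edges_def)
qed


section \<open>Upstream partitions, the upstream grading, minimal generating sets\<close>

definition upstream_partition ::
    "nat \<Rightarrow> (nat \<times> nat) set \<Rightarrow> nat set \<Rightarrow> nat set \<Rightarrow> bool"
  where "upstream_partition n E Hid Obs \<longleftrightarrow>
    Hid \<union> Obs = {1..n} \<and> Hid \<inter> Obs = {} \<and> \<not> (\<exists>x\<in>Obs. \<exists>h\<in>Hid. (x, h) \<in> E)"

definition upstream_degree :: "nat set \<Rightarrow> nat set \<Rightarrow> nat \<times> nat \<Rightarrow> int \<times> int"
  where "upstream_degree Hid Obs = (\<lambda>(i, j).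
    if i \<in> Hid \<and> j \<in> Hid then (1, 0)
    else if i \<in> Obs \<and> j \<in> Obs then (1, 2)
    else (1, 1))"

definition monom_degree :: "('v \<Rightarrow> int \<times> int) \<Rightarrow> ('v \<Rightarrow>\<^sub>0 nat) \<Rightarrow> int \<times> int"
  where "monom_degree d m =
    (\<Sum>v\<in>Poly_Mapping.keys m. int (Poly_Mapping.lookup m v) * fst (d v),
     \<Sum>v\<in>Poly_Mapping.keys m. int (Poly_Mapping.lookup m v) * snd (d v))"

definition homogeneous :: "('v \<Rightarrow> int \<times> int) \<Rightarrow> 'v cpoly \<Rightarrow> bool"
  where "homogeneous d p \<longleftrightarrow> (\<exists>e. \<forall>m\<in>Poly_Mapping.keys p. monom_degree d m = e)"

text \<open>Minimality is with respect to inclusion.\<close>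

definition minimal_generating_set :: "('a, 'b) ring_scheme \<Rightarrow> 'a set \<Rightarrow> 'a set \<Rightarrow> bool"
  where "minimal_generating_set R I S \<longleftrightarrow>
    S \<subseteq> carrier R \<and> Idl\<^bsub>R\<^esub> S = I \<and> (\<forall>T. T \<subset> S \<longrightarrow> Idl\<^bsub>R\<^esub> T \<noteq> I)"

end

theory Submission
  imports Defs "HOL-Algebra.QuotRing"
begin

text \<open>
  Put \<open>w(\<sigma>\<^sub>i\<^sub>j) = 2a - b\<close> where \<open>(a, b)\<close> is the upstream degree. This weight is nonnegative, and it
  vanishes exactly on the observed variables. Hence the retraction \<open>\<pi>\<close> that sets all other variables
  to zero fixes each homogeneous polynomial of weight zero and kills each one of positive weight.
  Applying \<open>\<pi>\<close> to an expression of \<open>f \<in> I\<^sub>G\<^sub>,\<^sub>O\<close> in the homogeneous generators \<open>S\<close> expresses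
  \<open>f = \<pi>(f)\<close> through the generators that lie in the observed ring. Minimality passes to them,
  since a redundant one would be redundant in \<open>S\<close>.
\<close>

lemma ring_hom_poly_ring_mono:
  assumes "V \<subseteq> W"
  shows "id \<in> ring_hom (poly_ring V) (poly_ring W)"
  using assms by (intro ring_hom_memI) auto

text \<open>The larger ideal contracts along the inclusion \<open>id\<close> to an ideal of the
  smaller ring that still contains \<open>A\<close>, so minimality of the generated ideal
  applies.\<close>

lemma genideal_poly_ring_mono:
  assumes "V \<subseteq> W" "A \<subseteq> carrier (poly_ring V)"
  shows "Idl\<^bsub>poly_ring V\<^esub> A \<subseteq> Idl\<^bsub>poly_ring W\<^esub> A"
proof -
  interpret V: cring "poly_ring V" by (rule cring_poly_ring)
  interpret W: cring "poly_ring W" by (rule cring_poly_ring)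
  interpret inc: ring_hom_ring "poly_ring V" "poly_ring W" id
    by (rule ring_hom_ringI2[OF V.ring_axioms W.ring_axioms ring_hom_poly_ring_mono[OF assms(1)]])
  have A: "A \<subseteq> carrier (poly_ring W)" using assms by auto
  have "ideal {p \<in> carrier (poly_ring V). id p \<in> Idl\<^bsub>poly_ring W\<^esub> A} (poly_ring V)"
    by (rule inc.ideal_vimage[OF W.genideal_ideal[OF A]])
  then have "Idl\<^bsub>poly_ring V\<^esub> A \<subseteq> {p \<in> carrier (poly_ring V). id p \<in> Idl\<^bsub>poly_ring W\<^esub> A}"
    using assms(2) W.genideal_self[OF A] by (intro V.genideal_minimal) auto
  then show ?thesis by auto
qed

definition restrict_vars :: "'v set \<Rightarrow> 'v cpoly \<Rightarrow> 'v cpoly"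
  where "restrict_vars V = poly_subst (\<lambda>v. if v \<in> V then poly_var v else 0)"

lemma restrict_vars_ring_hom: "restrict_vars V \<in> ring_hom (poly_ring W) (poly_ring V)"
  unfolding restrict_vars_def by (rule poly_subst_ring_hom) simp

lemma poly_var_power: "poly_var v ^ k = Poly_Mapping.single (Poly_Mapping.single v k) 1"
  by (induction k) (simp_all add: poly_var_def mult_single flip: single_add)

lemma eval_monom_var: "eval_monom poly_var m = Poly_Mapping.single m 1"
proof -
  have "(\<Prod>v\<in>A. poly_var v ^ Poly_Mapping.lookup m v) =
      Poly_Mapping.single (\<Sum>v\<in>A. Poly_Mapping.single v (Poly_Mapping.lookup m v)) 1"
    if "finite A" for A
    using that by induction (simp_all add: poly_var_power mult_single)
  moreover have "(\<Sum>v\<in>Poly_Mapping.keys m. Poly_Mapping.single v (Poly_Mapping.lookup m v)) = m"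
    by (rule poly_mapping_eqI) (auto simp: lookup_sum lookup_single when_def in_keys_iff)
  ultimately show ?thesis by (simp add: eval_monom_def)
qed

lemma restrict_vars_id:
  assumes "poly_vars p \<subseteq> V"
  shows "restrict_vars V p = p"
proof -
  have "eval_monom (\<lambda>v. if v \<in> V then poly_var v else 0) m = Poly_Mapping.single m 1"
    if "m \<in> Poly_Mapping.keys p" for m
  proof -
    have "Poly_Mapping.keys m \<subseteq> V" using assms that by (auto simp: poly_vars_def)
    then have "eval_monom (\<lambda>v. if v \<in> V then poly_var v else 0) m = eval_monom poly_var m"
      unfolding eval_monom_def by (intro prod.cong) auto
    then show ?thesis by (simp add: eval_monom_var)
  qed
  then have "restrict_vars V p =
      (\<Sum>m\<in>Poly_Mapping.keys p. Poly_Mapping.single m (Poly_Mapping.lookup p m))"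
    unfolding restrict_vars_def poly_subst_def
    by (intro sum.cong) (simp_all add: poly_const_def mult_single)
  then show ?thesis using cpoly_sum_single[of p] by simp
qed

text \<open>Every monomial of \<open>p\<close> has a factor outside \<open>V\<close>, which is sent
  to 0 and occurs with a positive exponent.\<close>

lemma restrict_vars_eq_0:
  assumes "\<And>m. m \<in> Poly_Mapping.keys p \<Longrightarrow> \<not> Poly_Mapping.keys m \<subseteq> V"
  shows "restrict_vars V p = 0"
proof -
  have "eval_monom (\<lambda>v. if v \<in> V then poly_var v else 0) m = 0"
    if m: "m \<in> Poly_Mapping.keys p" for m
  proof -
    obtain v where "v \<in> Poly_Mapping.keys m" "v \<notin> V" using assms[OF m] by blast
    then show ?thesis
      unfolding eval_monom_def by (intro prod_zero bexI[of _ v]) (auto simp: in_keys_iff zero_power)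
  qed
  then show ?thesis by (simp add: restrict_vars_def poly_subst_def)
qed

text \<open>This isolates the ring theory from the grading: by \<open>dich\<close>, the retraction
  sends each generator either to itself or to 0, hence always into the ideal generated by
  \<open>?T\<close>.\<close>

lemma minimal_generating_set_restrict:
  assumes "V \<subseteq> W"
    and min: "minimal_generating_set (poly_ring W) I S"
    and dich: "\<And>g. g \<in> S \<Longrightarrow> poly_vars g \<subseteq> V \<or> restrict_vars V g = 0"
  shows "minimal_generating_set (poly_ring V) (I \<inter> carrier (poly_ring V))
    (S \<inter> carrier (poly_ring V))"
proof -
  let ?R = "poly_ring W" and ?R' = "poly_ring V"
  let ?T = "S \<inter> carrier ?R'"
  interpret R: cring ?R by (rule cring_poly_ring)
  interpret R': cring ?R' by (rule cring_poly_ring)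
  interpret retr: ring_hom_ring ?R ?R' "restrict_vars V"
    by (rule ring_hom_ringI2[OF R.ring_axioms R'.ring_axioms restrict_vars_ring_hom])
  have S: "S \<subseteq> carrier ?R" and I: "Idl\<^bsub>?R\<^esub> S = I"
    and irred: "\<And>U. U \<subset> S \<Longrightarrow> Idl\<^bsub>?R\<^esub> U \<noteq> I"
    using min by (auto simp: minimal_generating_set_def)
  have T: "?T \<subseteq> carrier ?R'" by blast
  interpret J: ideal "Idl\<^bsub>?R'\<^esub> ?T" ?R' by (rule R'.genideal_ideal[OF T])
  \<comment> \<open>The preimage of this ideal under the retraction is an ideal of the large ring;
    once it contains \<open>S\<close>, it contains all of \<open>I\<close>.\<close>
  have "ideal {p \<in> carrier ?R. restrict_vars V p \<in> Idl\<^bsub>?R'\<^esub> ?T} ?R"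
    by (rule retr.ideal_vimage[OF J.is_ideal])
  moreover have "restrict_vars V g \<in> Idl\<^bsub>?R'\<^esub> ?T" if "g \<in> S" for g
  proof (cases "poly_vars g \<subseteq> V")
    case True
    then show ?thesis
      using that R'.genideal_self[OF T] by (auto simp: restrict_vars_id)
  next
    case False
    then show ?thesis using dich[OF that] J.zero_closed by simp
  qed
  ultimately have "I \<subseteq> {p \<in> carrier ?R. restrict_vars V p \<in> Idl\<^bsub>?R'\<^esub> ?T}"
    using S unfolding I[symmetric] by (intro R.genideal_minimal) auto
  \<comment> \<open>Polynomials over \<open>V\<close> are fixed by the retraction, so for them
    membership of the image is membership of the polynomial itself.\<close>
  then have le: "I \<inter> carrier ?R' \<subseteq> Idl\<^bsub>?R'\<^esub> ?T"
    by (force simp: restrict_vars_id)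
  have "Idl\<^bsub>?R'\<^esub> ?T \<subseteq> I \<inter> carrier ?R'"
    using genideal_poly_ring_mono[OF assms(1) T] R.subset_Idl_subset[OF S, of ?T] I J.Icarr by blast
  with le have gen: "Idl\<^bsub>?R'\<^esub> ?T = I \<inter> carrier ?R'" by blast
  have "Idl\<^bsub>?R'\<^esub> U \<noteq> I \<inter> carrier ?R'" if U: "U \<subset> ?T" for U
  proof
    assume eq: "Idl\<^bsub>?R'\<^esub> U = I \<inter> carrier ?R'"
    \<comment> \<open>Trading \<open>?T\<close> for \<open>U\<close> inside \<open>S\<close> gives a
      proper subset of \<open>S\<close>; it recovers \<open>?T\<close> from \<open>U\<close>, so it
      would still generate \<open>I\<close>.\<close>
    let ?U = "(S - ?T) \<union> U"
    have sub: "?U \<subset> S" using U by blast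
    then have UR: "?U \<subseteq> carrier ?R" using S by blast
    have "?T \<subseteq> Idl\<^bsub>?R'\<^esub> U" using R'.genideal_self[OF T] unfolding gen eq .
    also have "\<dots> \<subseteq> Idl\<^bsub>?R\<^esub> U" using U by (intro genideal_poly_ring_mono[OF assms(1)]) blast
    also have "\<dots> \<subseteq> Idl\<^bsub>?R\<^esub> ?U" by (intro R.subset_Idl_subset UR) blast
    finally have "S \<subseteq> Idl\<^bsub>?R\<^esub> ?U" using R.genideal_self[OF UR] by blast
    then have "Idl\<^bsub>?R\<^esub> S \<subseteq> Idl\<^bsub>?R\<^esub> ?U" by (rule R.genideal_minimal[OF R.genideal_ideal[OF UR]])
    moreover have "Idl\<^bsub>?R\<^esub> ?U \<subseteq> Idl\<^bsub>?R\<^esub> S" using sub S by (intro R.subset_Idl_subset) blast+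
    ultimately show False using irred[OF sub] I by blast
  qed
  with gen T show ?thesis by (simp add: minimal_generating_set_def)
qed

text \<open>The weight of a variable is 2, 1 or 0 according to whether two, one or none of its
  indices are hidden. It is additive on monomials, and a sum of nonnegative terms vanishes only
  termwise.\<close>

lemma upstream_monom_degree_iff:
  assumes "Hid \<inter> Obs = {}" "Poly_Mapping.keys m \<subseteq> sigma_vars (Hid \<union> Obs)"
  shows "snd (monom_degree (upstream_degree Hid Obs) m) =
      2 * fst (monom_degree (upstream_degree Hid Obs) m) \<longleftrightarrow>
    Poly_Mapping.keys m \<subseteq> sigma_vars Obs"
proof -
  let ?w = "\<lambda>v. 2 * fst (upstream_degree Hid Obs v) - snd (upstream_degree Hid Obs v)"
  let ?f = "\<lambda>v. int (Poly_Mapping.lookup m v) * ?w v"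
  have w: "?w v \<ge> 0" "?w v = 0 \<longleftrightarrow> v \<in> sigma_vars Obs" if "v \<in> Poly_Mapping.keys m" for v
    using assms that by (auto simp: upstream_degree_def sigma_vars_def split: prod.splits)
  have "2 * fst (monom_degree (upstream_degree Hid Obs) m) -
      snd (monom_degree (upstream_degree Hid Obs) m) = (\<Sum>v\<in>Poly_Mapping.keys m. ?f v)"
    by (simp add: monom_degree_def sum_distrib_left sum_subtractf algebra_simps)
  moreover have "(\<Sum>v\<in>Poly_Mapping.keys m. ?f v) = 0 \<longleftrightarrow> (\<forall>v\<in>Poly_Mapping.keys m. ?f v = 0)"
    using w(1) by (intro sum_nonneg_eq_0_iff) auto
  \<comment> \<open>Exponents are nonzero on the support, so a term vanishes only if the weight of
    its variable does.\<close>
  moreover have "(\<forall>v\<in>Poly_Mapping.keys m. ?f v = 0) \<longleftrightarrow> Poly_Mapping.keys m \<subseteq> sigma_vars Obs"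
    using w(2) by (auto simp: in_keys_iff)
  ultimately show ?thesis by linarith
qed

text \<open>The common degree \<open>e\<close> decides for all monomials at once whether they are
  purely observed, so mixed behaviour within \<open>g\<close> cannot occur.\<close>

lemma homogeneous_upstream_cases:
  assumes "Hid \<inter> Obs = {}" "poly_vars g \<subseteq> sigma_vars (Hid \<union> Obs)"
    and "homogeneous (upstream_degree Hid Obs) g"
  shows "poly_vars g \<subseteq> sigma_vars Obs \<or> restrict_vars (sigma_vars Obs) g = 0"
proof -
  obtain e where e: "\<And>m. m \<in> Poly_Mapping.keys g \<Longrightarrow> monom_degree (upstream_degree Hid Obs) m = e"
    using assms(3) by (auto simp: homogeneous_def)
  have "Poly_Mapping.keys m \<subseteq> sigma_vars Obs \<longleftrightarrow> snd e = 2 * fst e"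
    if "m \<in> Poly_Mapping.keys g" for m
    using upstream_monom_degree_iff[OF assms(1), of m] e[OF that] that assms(2)
    by (auto simp: poly_vars_def)
  then show ?thesis
    by (cases "snd e = 2 * fst e") (auto simp: poly_vars_def intro!: restrict_vars_eq_0)
qed

theorem theorem6p4:
  fixes n :: nat and E :: "(nat \<times> nat) set" and Hid Obs :: "nat set"
    and S :: "(nat \<times> nat) cpoly set"
  assumes "ordered_dag n E"
    and "upstream_partition n E Hid Obs"
    and "minimal_generating_set (sigma_ring {1..n}) (I_graph n E) S"
    and "\<forall>f\<in>S. homogeneous (upstream_degree Hid Obs) f"
  shows "\<exists>T\<subseteq>S. minimal_generating_set (sigma_ring Obs) (I_graph_obs n E Obs) T"
proof -
  have part: "Hid \<union> Obs = {1..n}" "Hid \<inter> Obs = {}"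
    using assms(2) by (auto simp: upstream_partition_def)
  have "S \<subseteq> carrier (sigma_ring {1..n})"
    using assms(3) by (simp add: minimal_generating_set_def)
  then have "poly_vars g \<subseteq> sigma_vars Obs \<or> restrict_vars (sigma_vars Obs) g = 0" if "g \<in> S" for g
    using that assms(4) part by (intro homogeneous_upstream_cases[of Hid]) auto
  moreover have "sigma_vars Obs \<subseteq> sigma_vars {1..n}"
    using part by (auto simp: sigma_vars_def)
  ultimately have "minimal_generating_set (sigma_ring Obs) (I_graph_obs n E Obs)
      (S \<inter> carrier (sigma_ring Obs))"
    unfolding I_graph_obs_def using assms(3) by (intro minimal_generating_set_restrict)
  then show ?thesis by blast
qed

end
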